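(* Let $R$ be a commutative ring with nonzero identity, let $\delta$ be an expansion function of ideals of $R$, let $S$ be a multiplicatively closed subset of $R$, and let $\delta_S$ be an expansion function of ideals of $S^{-1}R$ such that $\delta_S(S^{-1}I)=S^{-1}(\delta(I))$ for each ideal $I$ of $R$. If $I$ is a $1$-absorbing $\delta$-primary ideal of $R$ such that $I\cap S=\varnothing$, then $S^{-1}I$ is a $1$-absorbing $\delta_S$-primary ideal of $S^{-1}R$.
   Context: For a commutative ring $T$ with nonzero identity, $\mathcal{I}(T)$ denotes the set of all ideals of $T$. A function $\delta:\mathcal{I}(T)\to\mathcal{I}(T)$ is an expansion function of ideals of $T$ if $L\subseteq\delta(L)$ for every ideal $L$, and $J\subseteq I$ implies $\delta(J)\subseteq\delta(I)$ for all ideals $I,J$. A proper ideal $I$ of $T$ is $1$-absorbing $\delta$-primary if whenever $a,b,c\in T$ are nonunits of $T$ with $abc\in I$, then $ab\in I$ or $c\in\delta(I)$. *)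

theory Defs
  imports "HOL-Algebra.QuotRing"
begin

section \<open>Rings of fractions\<close>

text \<open>
  The fraction a/s is the class of the pair (a, s) under the relation identifying (a, s) with
  (b, t) iff u(ta - sb) = 0 for some u in S. For S a multiplicatively closed set (containing 1),
  that is \<open>submonoid S R\<close>, the lemmas below show that this is an equivalence relation on R x S,
  that the ring operations do not depend on the representatives, and that the result is a
  commutative ring. Zero divisors are allowed in S.
\<close>

definition fraction :: "('a, 'm) ring_scheme \<Rightarrow> 'a set \<Rightarrow> 'a \<Rightarrow> 'a \<Rightarrow> ('a \<times> 'a) set" where
  "fraction R S a s =
     {(b, t). b \<in> carrier R \<and> t \<in> S \<and>
        (\<exists>u \<in> S. u \<otimes>\<^bsub>R\<^esub> (t \<otimes>\<^bsub>R\<^esub> a \<ominus>\<^bsub>R\<^esub> s \<otimes>\<^bsub>R\<^esub> b) = \<zero>\<^bsub>R\<^esub>)}"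

definition localization :: "('a, 'm) ring_scheme \<Rightarrow> 'a set \<Rightarrow> ('a \<times> 'a) set ring" where
  "localization R S =
     \<lparr> carrier = {fraction R S a s | a s. a \<in> carrier R \<and> s \<in> S},
       mult = (\<lambda>A B. \<Union>{fraction R S (a \<otimes>\<^bsub>R\<^esub> b) (s \<otimes>\<^bsub>R\<^esub> t) | a s b t.
                 (a, s) \<in> A \<and> (b, t) \<in> B}),
       one = fraction R S \<one>\<^bsub>R\<^esub> \<one>\<^bsub>R\<^esub>,
       zero = fraction R S \<zero>\<^bsub>R\<^esub> \<one>\<^bsub>R\<^esub>,
       add = (\<lambda>A B. \<Union>{fraction R S (t \<otimes>\<^bsub>R\<^esub> a \<oplus>\<^bsub>R\<^esub> s \<otimes>\<^bsub>R\<^esub> b) (s \<otimes>\<^bsub>R\<^esub> t) | a s b t.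
                (a, s) \<in> A \<and> (b, t) \<in> B}) \<rparr>"

definition localized_ideal :: "('a, 'm) ring_scheme \<Rightarrow> 'a set \<Rightarrow> 'a set \<Rightarrow> ('a \<times> 'a) set set" where
  "localized_ideal R S I = {fraction R S a s | a s. a \<in> I \<and> s \<in> S}"

locale cring_fractions = cring R + sub: submonoid S R for R (structure) and S
begin

lemma S_carrier [simp]: "s \<in> S \<Longrightarrow> s \<in> carrier R"
  using sub.subset by blast

lemmas [simp] = sub.m_closed sub.one_closed

lemma minus_eq_zero_iff:
  assumes "x \<in> carrier R" "y \<in> carrier R"
  shows "x \<ominus> y = \<zero> \<longleftrightarrow> x = y"
proof
  assume "x \<ominus> y = \<zero>"
  then have "(x \<oplus> \<ominus> y) \<oplus> y = y" using assms by (simp add: minus_eq)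
  then show "x = y" using assms by (simp add: a_assoc l_neg)
qed (use assms in \<open>simp add: minus_eq r_neg\<close>)

lemma frac_self: "a \<in> carrier R \<Longrightarrow> s \<in> S \<Longrightarrow> (a, s) \<in> fraction R S a s"
  unfolding fraction_def by (auto intro!: bexI[of _ \<one>] simp: minus_eq_zero_iff)

lemma frac_memD:
  assumes "(b, t) \<in> fraction R S a s"
  shows "b \<in> carrier R" "t \<in> S"
  using assms unfolding fraction_def by auto

lemma frac_mem_iff:
  assumes "a \<in> carrier R" "s \<in> S"
  shows "(b, t) \<in> fraction R S a s \<longleftrightarrow>
    b \<in> carrier R \<and> t \<in> S \<and> (\<exists>u \<in> S. u \<otimes> (t \<otimes> a) = u \<otimes> (s \<otimes> b))"
proof -
  have "u \<otimes> (t \<otimes> a \<ominus> s \<otimes> b) = \<zero> \<longleftrightarrow> u \<otimes> (t \<otimes> a) = u \<otimes> (s \<otimes> b)"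
    if "u \<in> S" "b \<in> carrier R" "t \<in> S" for u
  proof -
    have "u \<otimes> (t \<otimes> a \<ominus> s \<otimes> b) = u \<otimes> (t \<otimes> a) \<ominus> u \<otimes> (s \<otimes> b)"
      using assms that by (simp add: a_minus_def r_distr r_minus)
    then show ?thesis using assms that by (simp add: minus_eq_zero_iff)
  qed
  then show ?thesis unfolding fraction_def by auto
qed

lemma frac_memE:
  assumes "(b, t) \<in> fraction R S a s" "a \<in> carrier R" "s \<in> S"
  obtains u where "u \<in> S" "u \<otimes> (t \<otimes> a) = u \<otimes> (s \<otimes> b)"
  using assms(1) unfolding frac_mem_iff[OF assms(2,3)] by auto

lemma frac_memI:
  assumes "u \<otimes> (t \<otimes> a) = u \<otimes> (s \<otimes> b)" "u \<in> S"
    "a \<in> carrier R" "s \<in> S" "b \<in> carrier R" "t \<in> S"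
  shows "(b, t) \<in> fraction R S a s"
  unfolding frac_mem_iff[OF assms(3,4)] using assms by auto

lemma frac_sym:
  assumes "a \<in> carrier R" "s \<in> S" "(b, t) \<in> fraction R S a s"
  shows "(a, s) \<in> fraction R S b t"
  by (rule frac_memE[OF assms(3,1,2)], rule frac_memI, rule sym)
    (use assms frac_memD[OF assms(3)] in auto)

lemma frac_trans:
  assumes "a \<in> carrier R" "s \<in> S" "(b, t) \<in> fraction R S a s" "(c, w) \<in> fraction R S b t"
  shows "(c, w) \<in> fraction R S a s"
proof -
  note b = frac_memD[OF assms(3)] and c = frac_memD[OF assms(4)]
  obtain u where u: "u \<in> S" "u \<otimes> (t \<otimes> a) = u \<otimes> (s \<otimes> b)"
    by (rule frac_memE[OF assms(3,1,2)])
  obtain v where v: "v \<in> S" "v \<otimes> (w \<otimes> b) = v \<otimes> (t \<otimes> c)"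
    by (rule frac_memE[OF assms(4) b])
  have "(u \<otimes> v \<otimes> t) \<otimes> (w \<otimes> a) = (v \<otimes> w) \<otimes> (u \<otimes> (t \<otimes> a))"
    using assms b c u(1) v(1) by (simp add: m_ac)
  also have "\<dots> = (u \<otimes> s) \<otimes> (v \<otimes> (w \<otimes> b))"
    using assms b c u v(1) by (simp add: m_ac)
  also have "\<dots> = (u \<otimes> v \<otimes> t) \<otimes> (s \<otimes> c)"
    unfolding v(2) using assms b c u(1) v(1) by (simp add: m_ac)
  finally show ?thesis
    by (rule frac_memI) (use assms b c u(1) v(1) in simp_all)
qed

lemma frac_eq_mem_iff:
  assumes "a \<in> carrier R" "s \<in> S" "b \<in> carrier R" "t \<in> S"
  shows "fraction R S a s = fraction R S b t \<longleftrightarrow> (b, t) \<in> fraction R S a s"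
proof
  assume *: "(b, t) \<in> fraction R S a s"
  show "fraction R S a s = fraction R S b t"
  proof (intro equalityI subrelI)
    fix c w assume "(c, w) \<in> fraction R S b t"
    then show "(c, w) \<in> fraction R S a s" by (rule frac_trans[OF assms(1,2) *])
  next
    fix c w assume "(c, w) \<in> fraction R S a s"
    then show "(c, w) \<in> fraction R S b t"
      by (rule frac_trans[OF assms(3,4) frac_sym[OF assms(1,2) *]])
  qed
qed (use assms frac_self in auto)

lemma frac_eq_iff:
  assumes "a \<in> carrier R" "s \<in> S" "b \<in> carrier R" "t \<in> S"
  shows "fraction R S a s = fraction R S b t \<longleftrightarrow> (\<exists>u \<in> S. u \<otimes> (t \<otimes> a) = u \<otimes> (s \<otimes> b))"
  using assms by (simp add: frac_eq_mem_iff frac_mem_iff)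

lemma frac_mult_cong:
  assumes "a \<in> carrier R" "s \<in> S" "b \<in> carrier R" "t \<in> S"
    and "(a', s') \<in> fraction R S a s" "(b', t') \<in> fraction R S b t"
  shows "fraction R S (a' \<otimes> b') (s' \<otimes> t') = fraction R S (a \<otimes> b) (s \<otimes> t)"
proof -
  note a' = frac_memD[OF assms(5)] and b' = frac_memD[OF assms(6)]
  obtain u where u: "u \<in> S" "u \<otimes> (s' \<otimes> a) = u \<otimes> (s \<otimes> a')"
    by (rule frac_memE[OF assms(5,1,2)])
  obtain v where v: "v \<in> S" "v \<otimes> (t' \<otimes> b) = v \<otimes> (t \<otimes> b')"
    by (rule frac_memE[OF assms(6,3,4)])
  have "(u \<otimes> v) \<otimes> ((s \<otimes> t) \<otimes> (a' \<otimes> b')) = (u \<otimes> (s \<otimes> a')) \<otimes> (v \<otimes> (t \<otimes> b'))"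
    using assms a' b' u(1) v(1) by (simp add: m_ac)
  also have "\<dots> = (u \<otimes> v) \<otimes> ((s' \<otimes> t') \<otimes> (a \<otimes> b))"
    unfolding u(2)[symmetric] v(2)[symmetric] using assms a' b' u(1) v(1) by (simp add: m_ac)
  finally have "\<exists>w \<in> S. w \<otimes> ((s \<otimes> t) \<otimes> (a' \<otimes> b')) = w \<otimes> ((s' \<otimes> t') \<otimes> (a \<otimes> b))"
    using sub.m_closed[OF u(1) v(1)] by blast
  then show ?thesis
    using assms a' b' by (subst frac_eq_iff) auto
qed

lemma frac_add_cong:
  assumes "a \<in> carrier R" "s \<in> S" "b \<in> carrier R" "t \<in> S"
    and "(a', s') \<in> fraction R S a s" "(b', t') \<in> fraction R S b t"
  shows "fraction R S (t' \<otimes> a' \<oplus> s' \<otimes> b') (s' \<otimes> t') = fraction R S (t \<otimes> a \<oplus> s \<otimes> b) (s \<otimes> t)"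
proof -
  note a' = frac_memD[OF assms(5)] and b' = frac_memD[OF assms(6)]
  obtain u where u: "u \<in> S" "u \<otimes> (s' \<otimes> a) = u \<otimes> (s \<otimes> a')"
    by (rule frac_memE[OF assms(5,1,2)])
  obtain v where v: "v \<in> S" "v \<otimes> (t' \<otimes> b) = v \<otimes> (t \<otimes> b')"
    by (rule frac_memE[OF assms(6,3,4)])
  have "(u \<otimes> v) \<otimes> ((s \<otimes> t) \<otimes> (t' \<otimes> a' \<oplus> s' \<otimes> b'))
      = (v \<otimes> t \<otimes> t') \<otimes> (u \<otimes> (s \<otimes> a')) \<oplus> (u \<otimes> s \<otimes> s') \<otimes> (v \<otimes> (t \<otimes> b'))"
    using assms a' b' u(1) v(1) by (simp add: m_ac r_distr)
  also have "\<dots> = (u \<otimes> v) \<otimes> ((s' \<otimes> t') \<otimes> (t \<otimes> a \<oplus> s \<otimes> b))"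
    unfolding u(2)[symmetric] v(2)[symmetric]
    using assms a' b' u(1) v(1) by (simp add: m_ac r_distr)
  finally have "\<exists>w \<in> S. w \<otimes> ((s \<otimes> t) \<otimes> (t' \<otimes> a' \<oplus> s' \<otimes> b'))
      = w \<otimes> ((s' \<otimes> t') \<otimes> (t \<otimes> a \<oplus> s \<otimes> b))"
    using sub.m_closed[OF u(1) v(1)] by blast
  then show ?thesis
    using assms a' b' by (subst frac_eq_iff) auto
qed

lemma localization_carrier:
  "carrier (localization R S) = {fraction R S a s | a s. a \<in> carrier R \<and> s \<in> S}"
  by (simp add: localization_def)

lemma fraction_in_carrier [simp]:
  "a \<in> carrier R \<Longrightarrow> s \<in> S \<Longrightarrow> fraction R S a s \<in> carrier (localization R S)"
  unfolding localization_carrier by blast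

lemma localization_one: "\<one>\<^bsub>localization R S\<^esub> = fraction R S \<one> \<one>"
  by (simp add: localization_def)

lemma localization_zero: "\<zero>\<^bsub>localization R S\<^esub> = fraction R S \<zero> \<one>"
  by (simp add: localization_def)

lemma localization_mult:
  assumes "a \<in> carrier R" "s \<in> S" "b \<in> carrier R" "t \<in> S"
  shows "fraction R S a s \<otimes>\<^bsub>localization R S\<^esub> fraction R S b t = fraction R S (a \<otimes> b) (s \<otimes> t)"
proof -
  have "{fraction R S (a' \<otimes> b') (s' \<otimes> t') | a' s' b' t'.
           (a', s') \<in> fraction R S a s \<and> (b', t') \<in> fraction R S b t}
      = {fraction R S (a \<otimes> b) (s \<otimes> t)}"
    using frac_mult_cong[OF assms] frac_self[OF assms(1,2)] frac_self[OF assms(3,4)] by blast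
  then show ?thesis by (simp add: localization_def)
qed

lemma localization_add:
  assumes "a \<in> carrier R" "s \<in> S" "b \<in> carrier R" "t \<in> S"
  shows "fraction R S a s \<oplus>\<^bsub>localization R S\<^esub> fraction R S b t
       = fraction R S (t \<otimes> a \<oplus> s \<otimes> b) (s \<otimes> t)"
proof -
  have "{fraction R S (t' \<otimes> a' \<oplus> s' \<otimes> b') (s' \<otimes> t') | a' s' b' t'.
           (a', s') \<in> fraction R S a s \<and> (b', t') \<in> fraction R S b t}
      = {fraction R S (t \<otimes> a \<oplus> s \<otimes> b) (s \<otimes> t)}"
    using frac_add_cong[OF assms] frac_self[OF assms(1,2)] frac_self[OF assms(3,4)] by blast
  then show ?thesis by (simp add: localization_def)
qed

lemma frac_cancel:
  assumes "a \<in> carrier R" "s \<in> S" "t \<in> S"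
  shows "fraction R S (t \<otimes> a) (t \<otimes> s) = fraction R S a s"
  using assms by (subst frac_eq_iff) (auto intro!: bexI[of _ \<one>] simp: m_ac)

lemma cring_localization: "cring (localization R S)"
proof (rule cringI)
  let ?Q = "localization R S"
  show "abelian_group ?Q"
  proof (rule abelian_groupI)
    fix x y z assume "x \<in> carrier ?Q" "y \<in> carrier ?Q" "z \<in> carrier ?Q"
    then obtain a s b t c u where *: "x = fraction R S a s" "y = fraction R S b t" "z = fraction R S c u"
      "a \<in> carrier R" "s \<in> S" "b \<in> carrier R" "t \<in> S" "c \<in> carrier R" "u \<in> S"
      by (auto simp: localization_carrier)
    show "x \<oplus>\<^bsub>?Q\<^esub> y \<oplus>\<^bsub>?Q\<^esub> z = x \<oplus>\<^bsub>?Q\<^esub> (y \<oplus>\<^bsub>?Q\<^esub> z)"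
      using * by (simp add: localization_add r_distr m_ac a_ac)
  next
    fix x y assume "x \<in> carrier ?Q" "y \<in> carrier ?Q"
    then obtain a s b t where *: "x = fraction R S a s" "y = fraction R S b t"
      "a \<in> carrier R" "s \<in> S" "b \<in> carrier R" "t \<in> S"
      by (auto simp: localization_carrier)
    show "x \<oplus>\<^bsub>?Q\<^esub> y \<in> carrier ?Q"
      using * by (simp add: localization_add)
    show "x \<oplus>\<^bsub>?Q\<^esub> y = y \<oplus>\<^bsub>?Q\<^esub> x"
      using * by (simp add: localization_add m_comm a_comm)
  next
    show "\<zero>\<^bsub>?Q\<^esub> \<in> carrier ?Q"
      by (simp add: localization_zero)
  next
    fix x assume "x \<in> carrier ?Q"
    then obtain a s where *: "x = fraction R S a s" "a \<in> carrier R" "s \<in> S"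
      by (auto simp: localization_carrier)
    show "\<zero>\<^bsub>?Q\<^esub> \<oplus>\<^bsub>?Q\<^esub> x = x"
      using * by (simp add: localization_add localization_zero)
    have "s \<otimes> (\<ominus> a) \<oplus> s \<otimes> a = \<zero>"
      using * by (simp add: r_distr[symmetric] l_neg)
    then have "fraction R S (\<ominus> a) s \<oplus>\<^bsub>?Q\<^esub> x = fraction R S \<zero> (s \<otimes> s)"
      using * by (simp add: localization_add)
    also have "\<dots> = \<zero>\<^bsub>?Q\<^esub>"
      unfolding localization_zero using * by (subst frac_eq_iff) auto
    finally show "\<exists>y \<in> carrier ?Q. y \<oplus>\<^bsub>?Q\<^esub> x = \<zero>\<^bsub>?Q\<^esub>"
      using * by (intro bexI[of _ "fraction R S (\<ominus> a) s"]) simp_all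
  qed
next
  let ?Q = "localization R S"
  show "comm_monoid ?Q"
  proof (rule comm_monoidI)
    fix x y z assume "x \<in> carrier ?Q" "y \<in> carrier ?Q" "z \<in> carrier ?Q"
    then obtain a s b t c u where *: "x = fraction R S a s" "y = fraction R S b t" "z = fraction R S c u"
      "a \<in> carrier R" "s \<in> S" "b \<in> carrier R" "t \<in> S" "c \<in> carrier R" "u \<in> S"
      by (auto simp: localization_carrier)
    show "x \<otimes>\<^bsub>?Q\<^esub> y \<otimes>\<^bsub>?Q\<^esub> z = x \<otimes>\<^bsub>?Q\<^esub> (y \<otimes>\<^bsub>?Q\<^esub> z)"
      using * by (simp add: localization_mult m_ac)
  next
    fix x y assume "x \<in> carrier ?Q" "y \<in> carrier ?Q"
    then obtain a s b t where *: "x = fraction R S a s" "y = fraction R S b t"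
      "a \<in> carrier R" "s \<in> S" "b \<in> carrier R" "t \<in> S"
      by (auto simp: localization_carrier)
    show "x \<otimes>\<^bsub>?Q\<^esub> y \<in> carrier ?Q"
      using * by (simp add: localization_mult)
    show "x \<otimes>\<^bsub>?Q\<^esub> y = y \<otimes>\<^bsub>?Q\<^esub> x"
      using * by (simp add: localization_mult m_comm)
  next
    show "\<one>\<^bsub>?Q\<^esub> \<in> carrier ?Q"
      by (simp add: localization_one)
  next
    fix x assume "x \<in> carrier ?Q"
    then show "\<one>\<^bsub>?Q\<^esub> \<otimes>\<^bsub>?Q\<^esub> x = x"
      by (auto simp: localization_carrier localization_mult localization_one)
  qed
next
  let ?Q = "localization R S"
  fix x y z assume "x \<in> carrier ?Q" "y \<in> carrier ?Q" "z \<in> carrier ?Q"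
  then obtain a s b t c u where *: "x = fraction R S a s" "y = fraction R S b t" "z = fraction R S c u"
    "a \<in> carrier R" "s \<in> S" "b \<in> carrier R" "t \<in> S" "c \<in> carrier R" "u \<in> S"
    by (auto simp: localization_carrier)
  have "(x \<oplus>\<^bsub>?Q\<^esub> y) \<otimes>\<^bsub>?Q\<^esub> z = fraction R S ((t \<otimes> a \<oplus> s \<otimes> b) \<otimes> c) (s \<otimes> t \<otimes> u)"
    using * by (simp add: localization_add localization_mult)
  also have "\<dots> = fraction R S (u \<otimes> ((t \<otimes> a \<oplus> s \<otimes> b) \<otimes> c)) (u \<otimes> (s \<otimes> t \<otimes> u))"
    using * by (subst frac_cancel) auto
  also have "\<dots> = x \<otimes>\<^bsub>?Q\<^esub> z \<oplus>\<^bsub>?Q\<^esub> y \<otimes>\<^bsub>?Q\<^esub> z"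
    using * by (simp add: localization_add localization_mult l_distr r_distr m_ac)
  finally show "(x \<oplus>\<^bsub>?Q\<^esub> y) \<otimes>\<^bsub>?Q\<^esub> z = x \<otimes>\<^bsub>?Q\<^esub> z \<oplus>\<^bsub>?Q\<^esub> y \<otimes>\<^bsub>?Q\<^esub> z" .
qed

end


section \<open>Expansion functions and 1-absorbing primary ideals\<close>

text \<open>
  An expansion function is a total function on sets of which only the values at ideals matter.
\<close>

definition ideal_expansion :: "('a, 'm) ring_scheme \<Rightarrow> ('a set \<Rightarrow> 'a set) \<Rightarrow> bool" where
  "ideal_expansion T \<delta> \<longleftrightarrow>
     (\<forall>L. ideal L T \<longrightarrow> ideal (\<delta> L) T) \<and>
     (\<forall>L. ideal L T \<longrightarrow> L \<subseteq> \<delta> L) \<and>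
     (\<forall>I J. ideal I T \<longrightarrow> ideal J T \<longrightarrow> J \<subseteq> I \<longrightarrow> \<delta> J \<subseteq> \<delta> I)"

definition one_absorbing_primary ::
    "('a, 'm) ring_scheme \<Rightarrow> ('a set \<Rightarrow> 'a set) \<Rightarrow> 'a set \<Rightarrow> bool" where
  "one_absorbing_primary T \<delta> I \<longleftrightarrow>
     ideal I T \<and> I \<noteq> carrier T \<and>
     (\<forall>a \<in> carrier T - Units T. \<forall>b \<in> carrier T - Units T. \<forall>c \<in> carrier T - Units T.
        a \<otimes>\<^bsub>T\<^esub> b \<otimes>\<^bsub>T\<^esub> c \<in> I \<longrightarrow> a \<otimes>\<^bsub>T\<^esub> b \<in> I \<or> c \<in> \<delta> I)"

end

theory Submission
  imports Defs "HOL-Algebra.Divisibility"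
begin

text \<open>
  If the product of a/s, b/t, c/u lies in the localized ideal, then v(abc) is in I for some v in S.
  A unit of R stays a unit in the localization, so b, c and va are nonunits of R and the hypothesis
  on I applies to the triple (va, b, c); the factor v is absorbed again on passing to fractions.
\<close>

context cring_fractions
begin

text \<open>If a/s = i/t with i in I, clearing denominators gives u(ta) = u(si), so v = ut
  multiplies a into I. Conversely, a/s = (va)/(vs). The factor v has to stay in the criterion: a/s
  may be represented by a numerator in I without a itself lying in I.\<close>

lemma fraction_in_localized_ideal_iff:
  assumes "ideal I R" "a \<in> carrier R" "s \<in> S"
  shows "fraction R S a s \<in> localized_ideal R S I \<longleftrightarrow> (\<exists>v\<in>S. v \<otimes> a \<in> I)"
proof
  interpret I: ideal I R by fact
  assume "fraction R S a s \<in> localized_ideal R S I"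
  then obtain i t where it: "i \<in> I" "t \<in> S" "fraction R S a s = fraction R S i t"
    unfolding localized_ideal_def by auto
  then obtain u where u: "u \<in> S" "u \<otimes> (t \<otimes> a) = u \<otimes> (s \<otimes> i)"
    using assms by (auto simp: frac_eq_iff)
  have "(u \<otimes> t) \<otimes> a = u \<otimes> (s \<otimes> i)"
    using u it assms by (simp add: m_assoc)
  also have "\<dots> \<in> I"
    using u it assms by (simp add: I.I_l_closed)
  finally show "\<exists>v\<in>S. v \<otimes> a \<in> I"
    using u it by (meson sub.m_closed)
next
  assume "\<exists>v\<in>S. v \<otimes> a \<in> I"
  then obtain v where v: "v \<in> S" "v \<otimes> a \<in> I" by blast
  have "fraction R S a s = fraction R S (v \<otimes> a) (v \<otimes> s)"
    using assms v by (simp add: frac_cancel)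
  then show "fraction R S a s \<in> localized_ideal R S I"
    unfolding localized_ideal_def using assms v by fastforce
qed

text \<open>Over the common denominator st, the sum of i/s and j/t has numerator ti + sj, and I is
  closed under such combinations. Absorption is similar, with numerator bi.\<close>

lemma ideal_localized_ideal:
  assumes "ideal I R"
  shows "ideal (localized_ideal R S I) (localization R S)"
proof -
  interpret I: ideal I R by fact
  let ?Q = "localization R S"
  interpret Q: cring ?Q by (rule cring_localization)
  \<comment> \<open>Absorption is settled before the additive structure because closure under
    negation is derived from it.\<close>
  have ideal_mult: "q \<otimes>\<^bsub>?Q\<^esub> x \<in> localized_ideal R S I"
    if "x \<in> localized_ideal R S I" "q \<in> carrier ?Q" for x q
  proof -
    obtain i s where x: "i \<in> I" "s \<in> S" "x = fraction R S i s"
      using \<open>x \<in> localized_ideal R S I\<close> unfolding localized_ideal_def by auto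
    obtain b t where q: "b \<in> carrier R" "t \<in> S" "q = fraction R S b t"
      using \<open>q \<in> carrier ?Q\<close> unfolding localization_carrier by auto
    have "q \<otimes>\<^bsub>?Q\<^esub> x = fraction R S (b \<otimes> i) (t \<otimes> s)"
      using x q by (simp add: localization_mult)
    then show ?thesis
      unfolding localized_ideal_def using x q I.I_l_closed sub.m_closed by blast
  qed
  have sub: "localized_ideal R S I \<subseteq> carrier ?Q"
    unfolding localized_ideal_def localization_carrier using I.Icarr by blast
  have "subgroup (localized_ideal R S I) (add_monoid ?Q)"
  proof (rule Q.add.subgroupI)
    show "localized_ideal R S I \<subseteq> carrier ?Q" by (rule sub)
    show "localized_ideal R S I \<noteq> {}"
      unfolding localized_ideal_def using I.zero_closed sub.one_closed by blast
  next
    fix x assume x: "x \<in> localized_ideal R S I"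
    \<comment> \<open>Negation is multiplication by -1, an element of the localization, so no
      representative of x has to be negated.\<close>
    then have "\<ominus>\<^bsub>?Q\<^esub> x = (\<ominus>\<^bsub>?Q\<^esub> \<one>\<^bsub>?Q\<^esub>) \<otimes>\<^bsub>?Q\<^esub> x"
      using sub by (auto simp: Q.l_minus)
    then show "\<ominus>\<^bsub>?Q\<^esub> x \<in> localized_ideal R S I"
      using ideal_mult[OF x] by simp
  next
    fix x y assume "x \<in> localized_ideal R S I" "y \<in> localized_ideal R S I"
    then obtain i s j t where *: "i \<in> I" "s \<in> S" "x = fraction R S i s"
      "j \<in> I" "t \<in> S" "y = fraction R S j t"
      unfolding localized_ideal_def by auto
    then have "x \<oplus>\<^bsub>?Q\<^esub> y = fraction R S (t \<otimes> i \<oplus> s \<otimes> j) (s \<otimes> t)"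
      by (simp add: localization_add)
    moreover have "t \<otimes> i \<oplus> s \<otimes> j \<in> I"
      using * by (simp add: I.I_l_closed)
    ultimately show "x \<oplus>\<^bsub>?Q\<^esub> y \<in> localized_ideal R S I"
      unfolding localized_ideal_def using * sub.m_closed by blast
  qed
  then show ?thesis
  proof (rule idealI[OF Q.ring_axioms])
    fix x q assume x: "x \<in> localized_ideal R S I" and q: "q \<in> carrier ?Q"
    show "q \<otimes>\<^bsub>?Q\<^esub> x \<in> localized_ideal R S I"
      using x q by (rule ideal_mult)
    then show "x \<otimes>\<^bsub>?Q\<^esub> q \<in> localized_ideal R S I"
      using Q.m_comm[of x q] x q sub by auto
  qed
qed

text \<open>If 1/1 were in the localized ideal, the membership criterion would put some v = v1 with
  v in S into I, against disjointness.\<close>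

lemma localized_ideal_proper:
  assumes "ideal I R" "I \<inter> S = {}"
  shows "localized_ideal R S I \<noteq> carrier (localization R S)"
proof
  assume "localized_ideal R S I = carrier (localization R S)"
  then have "fraction R S \<one> \<one> \<in> localized_ideal R S I" by simp
  then show False
    using assms by (auto simp: fraction_in_localized_ideal_iff)
qed

text \<open>The inverse of a/s is (s inv a)/1. In contrapositive form, this makes the numerators of
  nonunit fractions nonunits of R.\<close>

lemma fraction_Units:
  assumes "a \<in> Units R" "s \<in> S"
  shows "fraction R S a s \<in> Units (localization R S)"
proof -
  let ?Q = "localization R S"
  interpret Q: cring ?Q by (rule cring_localization)
  \<comment> \<open>The factor \<one> is kept on the right so that the product of fractions takes
    the form (s1)/(s1), which \<open>frac_cancel\<close> reduces to 1/1.\<close>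
  have "a \<otimes> (s \<otimes> inv a) = s \<otimes> \<one>"
    using assms m_lcomm[of a s "inv a"] by (simp add: Units_closed)
  then have "fraction R S a s \<otimes>\<^bsub>?Q\<^esub> fraction R S (s \<otimes> inv a) \<one> = fraction R S (s \<otimes> \<one>) (s \<otimes> \<one>)"
    using assms by (simp add: localization_mult Units_closed)
  also have "\<dots> = \<one>\<^bsub>?Q\<^esub>"
    unfolding localization_one using assms(2) by (intro frac_cancel) simp_all
  also have "\<dots> \<in> Units ?Q"
    by (rule Q.Units_one_closed)
  \<comment> \<open>In a commutative monoid, a factor of a unit is a unit.\<close>
  finally show ?thesis
    by (rule Q.unit_factor) (use assms in auto)
qed

end

theorem proposition2p26:
  fixes R :: "('a, 'm) ring_scheme"
    and S I :: "'a set"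
    and \<delta> :: "'a set \<Rightarrow> 'a set"
    and \<delta>\<^sub>S :: "('a \<times> 'a) set set \<Rightarrow> ('a \<times> 'a) set set"
  assumes "cring R" and "\<one>\<^bsub>R\<^esub> \<noteq> \<zero>\<^bsub>R\<^esub>"
    and "ideal_expansion R \<delta>"
    and "submonoid S R"
    and "ideal_expansion (localization R S) \<delta>\<^sub>S"
    and "\<And>J. ideal J R \<Longrightarrow> \<delta>\<^sub>S (localized_ideal R S J) = localized_ideal R S (\<delta> J)"
    and "one_absorbing_primary R \<delta> I"
    and "I \<inter> S = {}"
  shows "one_absorbing_primary (localization R S) \<delta>\<^sub>S (localized_ideal R S I)"
proof -
  interpret cring_fractions R S
    using assms(1,4) by (rule cring_fractions.intro)
  let ?Q = "localization R S"
  have I: "ideal I R" and absorb: "\<And>a b c. \<lbrakk>a \<in> carrier R - Units R; b \<in> carrier R - Units R;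
      c \<in> carrier R - Units R; a \<otimes>\<^bsub>R\<^esub> b \<otimes>\<^bsub>R\<^esub> c \<in> I\<rbrakk> \<Longrightarrow> a \<otimes>\<^bsub>R\<^esub> b \<in> I \<or> c \<in> \<delta> I"
    using assms(7) unfolding one_absorbing_primary_def by blast+
  have "x \<otimes>\<^bsub>?Q\<^esub> y \<in> localized_ideal R S I \<or> z \<in> \<delta>\<^sub>S (localized_ideal R S I)"
    if x: "x \<in> carrier ?Q - Units ?Q" and y: "y \<in> carrier ?Q - Units ?Q"
      and z: "z \<in> carrier ?Q - Units ?Q"
      and xyz: "x \<otimes>\<^bsub>?Q\<^esub> y \<otimes>\<^bsub>?Q\<^esub> z \<in> localized_ideal R S I" for x y z
  proof -
    obtain a s b t c u where eq: "x = fraction R S a s" "y = fraction R S b t" "z = fraction R S c u"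
      and R: "a \<in> carrier R" "b \<in> carrier R" "c \<in> carrier R" and S: "s \<in> S" "t \<in> S" "u \<in> S"
      using x y z unfolding localization_carrier by auto
    have nonunits: "a \<notin> Units R" "b \<notin> Units R" "c \<notin> Units R"
      using x y z S fraction_Units unfolding eq by blast+
    obtain v where v: "v \<in> S" "v \<otimes>\<^bsub>R\<^esub> (a \<otimes>\<^bsub>R\<^esub> b \<otimes>\<^bsub>R\<^esub> c) \<in> I"
      using xyz R S unfolding eq
      by (simp add: localization_mult fraction_in_localized_ideal_iff[OF I]) blast
    \<comment> \<open>Were va a unit, its factor a would be one too. Attaching v to a rather than to
      c leaves the alternative that c is in \<delta>(I) free of v.\<close>
    have "v \<otimes>\<^bsub>R\<^esub> a \<notin> Units R"
      using nonunits(1) R v(1) unit_factor[of a v] m_comm[of v a] by auto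
    then have "v \<otimes>\<^bsub>R\<^esub> a \<otimes>\<^bsub>R\<^esub> b \<in> I \<or> c \<in> \<delta> I"
      using absorb[of "v \<otimes>\<^bsub>R\<^esub> a" b c] R nonunits v by (simp add: m_assoc)
    then show ?thesis
    proof
      assume "v \<otimes>\<^bsub>R\<^esub> a \<otimes>\<^bsub>R\<^esub> b \<in> I"
      then show ?thesis
        \<comment> \<open>The same v is the witness in the membership criterion for xy =
          (ab)/(st).\<close>
        using R S v(1) unfolding eq
        by (simp add: localization_mult fraction_in_localized_ideal_iff[OF I] m_assoc) blast
    next
      assume "c \<in> \<delta> I"
      then have "z \<in> localized_ideal R S (\<delta> I)"
        unfolding eq localized_ideal_def using S by blast
      \<comment> \<open>Here the compatibility of \<open>\<delta>\<^sub>S\<close> with localization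
        enters, applied to I itself.\<close>
      then show ?thesis
        by (simp add: assms(6)[OF I])
    qed
  qed
  then show ?thesis
    unfolding one_absorbing_primary_def
    using ideal_localized_ideal[OF I] localized_ideal_proper[OF I assms(8)] by blast
qed

end
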